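(* Let $\sigma$ be a fuzzy propositional signature, $\mathbf{p}\subseteq\sigma$, $F$ a fuzzy formula of $\sigma$, $I$ an interpretation of $\sigma$, and $y\in[0,1]$. Let $\rightarrow$ be a fuzzy implication satisfying, for all $a,b\in[0,1]$: $\rightarrow\!(a,b)=1$ if and only if $b\ge a$. Then $I$ is a $y$-stable model of $F$ relative to $\mathbf{p}$ if and only if $I$ is a $1$-stable model of the fuzzy formula $y\rightarrow F$ relative to $\mathbf{p}$.
   Context: A fuzzy propositional signature $\sigma$ is a set of symbols (fuzzy atoms). Fuzzy formulas of $\sigma$ are built from atoms of $\sigma$ and numeric constants $c\in[0,1]$ using fuzzy negation symbols $\neg$ (unary) and fuzzy conjunction symbols $\otimes$, disjunction symbols $\oplus$ and implication symbols $\rightarrow$ (binary); a formula may use several different operators of each kind. Each symbol is identified with a function on $[0,1]$ (resp. $[0,1]^2\to[0,1]$), where "increasing/decreasing" is non-strict: $\neg$ is decreasing with $\neg(0)=1$, $\neg(1)=0$; $\otimes$ is increasing in both arguments, commutative, associative, $\otimes(1,x)=x$; $\oplus$ is increasing in both arguments, commutative, associative, $\oplus(0,x)=x$; $\rightarrow$ is decreasing in its first and increasing in its second argument, $\rightarrow\!(1,x)=x$ for all $x$, and $\rightarrow\!(0,0)=1$. Also $\otimes_m(x,y)=\min(x,y)$. An interpretation of $\sigma$ is a map $I:\sigma\to[0,1]$. The truth value $\upsilon_I(F)$ is defined by $\upsilon_I(p)=I(p)$, $\upsilon_I(c)=c$, $\upsilon_I(\neg F)=\neg(\upsilon_I(F))$,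 $\upsilon_I(F\odot G)=\odot(\upsilon_I(F),\upsilon_I(G))$ for $\odot\in\{\otimes,\oplus,\rightarrow\}$. The reduct $F^I$ of $F$ relative to $I$ is defined recursively: $F^I=F$ if $F$ is an atom or a numeric constant; $(\neg F)^I=\upsilon_I(\neg F)$ (a numeric constant); $(F\odot G)^I=(F^I\odot G^I)\otimes_m\upsilon_I(F\odot G)$ for $\odot\in\{\otimes,\oplus,\rightarrow\}$. For $\mathbf{p}\subseteq\sigma$, $J\le^{\mathbf{p}}I$ means $J(p)=I(p)$ for all atoms $p\notin\mathbf{p}$ and $J(p)\le I(p)$ for all $p\in\mathbf{p}$; $J<^{\mathbf{p}}I$ means $J\le^{\mathbf{p}}I$ and $J\ne I$. For $y\in[0,1]$, $I\models_y F$ means $\upsilon_I(F)\ge y$. $I$ is a $y$-stable model of $F$ relative to $\mathbf{p}$ if $I\models_y F$ and there is no interpretation $J$ with $J<^{\mathbf{p}}I$ and $J\models_y F^I$. *)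

theory Defs
  imports Complex_Main "HOL-Library.FuncSet"
begin

abbreviation unit_interval :: "real set"  (\<open>\<bbbU>\<close>)
  where "\<bbbU> \<equiv> {0..1}"

text \<open>
  An operator symbol is identified with a function on the unit interval, here a function on
  the reals whose values outside \<open>\<bbbU>\<close> are irrelevant. All conditions are relativised to \<open>\<bbbU>\<close>,
  and \<open>mono_on\<close>/\<open>antimono_on\<close> are non-strict.
\<close>

definition fuzzy_negation :: "(real \<Rightarrow> real) \<Rightarrow> bool" where
  "fuzzy_negation neg \<longleftrightarrow>
     neg \<in> \<bbbU> \<rightarrow> \<bbbU> \<and> antimono_on \<bbbU> neg \<and> neg 0 = 1 \<and> neg 1 = 0"

definition fuzzy_conjunction :: "(real \<Rightarrow> real \<Rightarrow> real) \<Rightarrow> bool" where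
  "fuzzy_conjunction con \<longleftrightarrow>
     con \<in> \<bbbU> \<rightarrow> \<bbbU> \<rightarrow> \<bbbU> \<and>
     (\<forall>a\<in>\<bbbU>. mono_on \<bbbU> (\<lambda>x. con x a) \<and> mono_on \<bbbU> (\<lambda>x. con a x)) \<and>
     (\<forall>a\<in>\<bbbU>. \<forall>b\<in>\<bbbU>. con a b = con b a) \<and>
     (\<forall>a\<in>\<bbbU>. \<forall>b\<in>\<bbbU>. \<forall>c\<in>\<bbbU>. con (con a b) c = con a (con b c)) \<and>
     (\<forall>x\<in>\<bbbU>. con 1 x = x)"

definition fuzzy_disjunction :: "(real \<Rightarrow> real \<Rightarrow> real) \<Rightarrow> bool" where
  "fuzzy_disjunction dis \<longleftrightarrow>
     dis \<in> \<bbbU> \<rightarrow> \<bbbU> \<rightarrow> \<bbbU> \<and>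
     (\<forall>a\<in>\<bbbU>. mono_on \<bbbU> (\<lambda>x. dis x a) \<and> mono_on \<bbbU> (\<lambda>x. dis a x)) \<and>
     (\<forall>a\<in>\<bbbU>. \<forall>b\<in>\<bbbU>. dis a b = dis b a) \<and>
     (\<forall>a\<in>\<bbbU>. \<forall>b\<in>\<bbbU>. \<forall>c\<in>\<bbbU>. dis (dis a b) c = dis a (dis b c)) \<and>
     (\<forall>x\<in>\<bbbU>. dis 0 x = x)"

definition fuzzy_implication :: "(real \<Rightarrow> real \<Rightarrow> real) \<Rightarrow> bool" where
  "fuzzy_implication imp \<longleftrightarrow>
     imp \<in> \<bbbU> \<rightarrow> \<bbbU> \<rightarrow> \<bbbU> \<and>
     (\<forall>a\<in>\<bbbU>. antimono_on \<bbbU> (\<lambda>x. imp x a) \<and> mono_on \<bbbU> (\<lambda>x. imp a x)) \<and>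
     (\<forall>x\<in>\<bbbU>. imp 1 x = x) \<and> imp 0 0 = 1"

text \<open>
  The operator is carried by each connective, so that one formula may use several operators
  of each kind. The datatype itself imposes no side conditions; the fuzzy formulas of a
  signature are those in \<open>fuzzy_formulas\<close>.
\<close>

datatype 'a fuzzy_formula =
    Atom 'a
  | Const real
  | Neg "real \<Rightarrow> real" "'a fuzzy_formula"
  | Con "real \<Rightarrow> real \<Rightarrow> real" "'a fuzzy_formula" "'a fuzzy_formula"
  | Dis "real \<Rightarrow> real \<Rightarrow> real" "'a fuzzy_formula" "'a fuzzy_formula"
  | Imp "real \<Rightarrow> real \<Rightarrow> real" "'a fuzzy_formula" "'a fuzzy_formula"

inductive_set fuzzy_formulas :: "'a set \<Rightarrow> 'a fuzzy_formula set" for \<sigma> :: "'a set" where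
  "a \<in> \<sigma> \<Longrightarrow> Atom a \<in> fuzzy_formulas \<sigma>"
| "c \<in> \<bbbU> \<Longrightarrow> Const c \<in> fuzzy_formulas \<sigma>"
| "\<lbrakk>fuzzy_negation neg; F \<in> fuzzy_formulas \<sigma>\<rbrakk> \<Longrightarrow> Neg neg F \<in> fuzzy_formulas \<sigma>"
| "\<lbrakk>fuzzy_conjunction con; F \<in> fuzzy_formulas \<sigma>; G \<in> fuzzy_formulas \<sigma>\<rbrakk>
     \<Longrightarrow> Con con F G \<in> fuzzy_formulas \<sigma>"
| "\<lbrakk>fuzzy_disjunction dis; F \<in> fuzzy_formulas \<sigma>; G \<in> fuzzy_formulas \<sigma>\<rbrakk>
     \<Longrightarrow> Dis dis F G \<in> fuzzy_formulas \<sigma>"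
| "\<lbrakk>fuzzy_implication imp; F \<in> fuzzy_formulas \<sigma>; G \<in> fuzzy_formulas \<sigma>\<rbrakk>
     \<Longrightarrow> Imp imp F G \<in> fuzzy_formulas \<sigma>"

text \<open>
  The extensional function space makes equality of interpretations the same as
  agreement on the signature.
\<close>

definition interpretations :: "'a set \<Rightarrow> ('a \<Rightarrow> real) set" where
  "interpretations \<sigma> = \<sigma> \<rightarrow>\<^sub>E \<bbbU>"

primrec truth_value :: "('a \<Rightarrow> real) \<Rightarrow> 'a fuzzy_formula \<Rightarrow> real" where
  "truth_value I (Atom a) = I a"
| "truth_value I (Const c) = c"
| "truth_value I (Neg neg F) = neg (truth_value I F)"
| "truth_value I (Con con F G) = con (truth_value I F) (truth_value I G)"
| "truth_value I (Dis dis F G) = dis (truth_value I F) (truth_value I G)"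
| "truth_value I (Imp imp F G) = imp (truth_value I F) (truth_value I G)"

primrec reduct :: "'a fuzzy_formula \<Rightarrow> ('a \<Rightarrow> real) \<Rightarrow> 'a fuzzy_formula" where
  "reduct (Atom a) I = Atom a"
| "reduct (Const c) I = Const c"
| "reduct (Neg neg F) I = Const (truth_value I (Neg neg F))"
| "reduct (Con con F G) I =
     Con min (Con con (reduct F I) (reduct G I)) (Const (truth_value I (Con con F G)))"
| "reduct (Dis dis F G) I =
     Con min (Dis dis (reduct F I) (reduct G I)) (Const (truth_value I (Dis dis F G)))"
| "reduct (Imp imp F G) I =
     Con min (Imp imp (reduct F I) (reduct G I)) (Const (truth_value I (Imp imp F G)))"

definition le_on_atoms :: "'a set \<Rightarrow> 'a set \<Rightarrow> ('a \<Rightarrow> real) \<Rightarrow> ('a \<Rightarrow> real) \<Rightarrow> bool" where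
  "le_on_atoms \<sigma> P J I \<longleftrightarrow> (\<forall>a \<in> \<sigma> - P. J a = I a) \<and> (\<forall>a \<in> P. J a \<le> I a)"

definition less_on_atoms :: "'a set \<Rightarrow> 'a set \<Rightarrow> ('a \<Rightarrow> real) \<Rightarrow> ('a \<Rightarrow> real) \<Rightarrow> bool" where
  "less_on_atoms \<sigma> P J I \<longleftrightarrow> le_on_atoms \<sigma> P J I \<and> J \<noteq> I"

definition satisfies :: "real \<Rightarrow> ('a \<Rightarrow> real) \<Rightarrow> 'a fuzzy_formula \<Rightarrow> bool" where
  "satisfies y I F \<longleftrightarrow> truth_value I F \<ge> y"

definition stable_model ::
    "'a set \<Rightarrow> 'a set \<Rightarrow> real \<Rightarrow> 'a fuzzy_formula \<Rightarrow> ('a \<Rightarrow> real) \<Rightarrow> bool" where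
  "stable_model \<sigma> P y F I \<longleftrightarrow>
     I \<in> interpretations \<sigma> \<and> satisfies y I F \<and>
     \<not> (\<exists>J \<in> interpretations \<sigma>. less_on_atoms \<sigma> P J I \<and> satisfies y J (reduct F I))"

end

theory Submission
  imports Defs
begin

text \<open>Truth values never exceed 1, so \<open>y \<rightarrow> G\<close> holds to degree 1
  exactly when its value equals 1, which by the assumption on \<open>imp\<close> means that
  \<open>G\<close> has value at least \<open>y\<close>. This applies to \<open>F\<close> under
  \<open>I\<close>, and also to the reduct of \<open>F\<close> under any competitor
  \<open>J\<close>. The reduct of \<open>y \<rightarrow> F\<close> only adds a cap by the value of
  \<open>y \<rightarrow> F\<close> under \<open>I\<close>, and that cap is 1 once \<open>I\<close>
  satisfies \<open>F\<close> to degree \<open>y\<close>. Hence both stability conditions admit the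
  same counterexamples \<open>J\<close>.\<close>

lemma truth_value_in_unit_interval:
  assumes "F \<in> fuzzy_formulas \<sigma>" "I \<in> interpretations \<sigma>"
  shows "truth_value I F \<in> \<bbbU>"
  using assms
proof (induction rule: fuzzy_formulas.induct)
  case (1 a)
  then show ?case by (auto simp: interpretations_def PiE_iff simp del: atLeastAtMost_iff)
next
  case (3 neg F)
  then show ?case by (auto simp: fuzzy_negation_def Pi_iff simp del: atLeastAtMost_iff)
next
  case (4 con F G)
  then show ?case by (auto simp: fuzzy_conjunction_def Pi_iff simp del: atLeastAtMost_iff)
next
  case (5 dis F G)
  then show ?case by (auto simp: fuzzy_disjunction_def Pi_iff simp del: atLeastAtMost_iff)
next
  case (6 imp F G)
  then show ?case by (auto simp: fuzzy_implication_def Pi_iff simp del: atLeastAtMost_iff)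
qed simp

lemma fuzzy_conjunction_min: "fuzzy_conjunction min"
  by (auto simp: fuzzy_conjunction_def mono_on_def min_def)

text \<open>The constants introduced by the reduct are truth values, hence legal, and
  \<open>min\<close> is a fuzzy conjunction. This lets the degree shift from \<open>y\<close> to 1
  be applied to reducts.\<close>

lemma reduct_in_fuzzy_formulas:
  assumes "F \<in> fuzzy_formulas \<sigma>" "I \<in> interpretations \<sigma>"
  shows "reduct F I \<in> fuzzy_formulas \<sigma>"
  using assms
proof (induction rule: fuzzy_formulas.induct)
  case (3 neg F)
  then have "truth_value I (Neg neg F) \<in> \<bbbU>"
    by (intro truth_value_in_unit_interval fuzzy_formulas.intros)
  then show ?case by (auto intro: fuzzy_formulas.intros)
next
  case (4 con F G)
  then have "truth_value I (Con con F G) \<in> \<bbbU>"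
    by (intro truth_value_in_unit_interval fuzzy_formulas.intros)
  with 4 show ?case by (auto intro!: fuzzy_formulas.intros fuzzy_conjunction_min)
next
  case (5 dis F G)
  then have "truth_value I (Dis dis F G) \<in> \<bbbU>"
    by (intro truth_value_in_unit_interval fuzzy_formulas.intros)
  with 5 show ?case by (auto intro!: fuzzy_formulas.intros fuzzy_conjunction_min)
next
  case (6 imp F G)
  then have "truth_value I (Imp imp F G) \<in> \<bbbU>"
    by (intro truth_value_in_unit_interval fuzzy_formulas.intros)
  with 6 show ?case by (auto intro!: fuzzy_formulas.intros fuzzy_conjunction_min)
qed (auto intro: fuzzy_formulas.intros)

theorem theorem1:
  fixes \<sigma> P :: "'a set" and F :: "'a fuzzy_formula" and I :: "'a \<Rightarrow> real" and y :: real
    and imp :: "real \<Rightarrow> real \<Rightarrow> real"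
  assumes "P \<subseteq> \<sigma>"
    and "F \<in> fuzzy_formulas \<sigma>"
    and "I \<in> interpretations \<sigma>"
    and "y \<in> \<bbbU>"
    and "fuzzy_implication imp"
    and "\<forall>a\<in>\<bbbU>. \<forall>b\<in>\<bbbU>. imp a b = 1 \<longleftrightarrow> b \<ge> a"
  shows "stable_model \<sigma> P y F I \<longleftrightarrow> stable_model \<sigma> P 1 (Imp imp (Const y) F) I"
proof -
  \<comment> \<open>Kept general in \<open>G\<close> and \<open>J\<close>: it serves both for
    \<open>F\<close> under \<open>I\<close> and for the reduct under \<open>J\<close>.\<close>
  have sat_imp: "satisfies 1 J (Imp imp (Const y) G) \<longleftrightarrow> satisfies y J G"
    if "G \<in> fuzzy_formulas \<sigma>" "J \<in> interpretations \<sigma>" for G J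
  proof -
    have t: "truth_value J G \<in> \<bbbU>"
      using that by (rule truth_value_in_unit_interval)
    then have "imp y (truth_value J G) \<in> \<bbbU>"
      using assms(4,5) unfolding fuzzy_implication_def by blast
    then have "imp y (truth_value J G) \<ge> 1 \<longleftrightarrow> imp y (truth_value J G) = 1"
      by auto
    also have "\<dots> \<longleftrightarrow> truth_value J G \<ge> y"
      using t assms(4,6) by blast
    finally show ?thesis by (simp add: satisfies_def)
  qed
  have sat_reduct: "satisfies 1 J (reduct (Imp imp (Const y) F) I) \<longleftrightarrow> satisfies y J (reduct F I)"
    if "satisfies y I F" "J \<in> interpretations \<sigma>" for J
  proof -
    \<comment> \<open>A minimum is at least 1 iff both arguments are; the second is the cap,
      evaluated under \<open>I\<close>.\<close>
    have "satisfies 1 J (reduct (Imp imp (Const y) F) I) \<longleftrightarrow>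
        satisfies 1 J (Imp imp (Const y) (reduct F I)) \<and> satisfies 1 I (Imp imp (Const y) F)"
      by (simp add: satisfies_def)
    also have "\<dots> \<longleftrightarrow> satisfies y J (reduct F I)"
      using sat_imp[OF assms(2,3)] sat_imp[OF reduct_in_fuzzy_formulas[OF assms(2,3)] that(2)] that(1)
      by blast
    finally show ?thesis .
  qed
  \<comment> \<open>If \<open>I\<close> does not satisfy \<open>F\<close> to degree
    \<open>y\<close>, both sides already fail; otherwise \<open>sat_reduct\<close> matches the
    competitors.\<close>
  show ?thesis
    unfolding stable_model_def using sat_imp[OF assms(2,3)] sat_reduct by blast
qed

end
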